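(* Let $P$ be a finite set of primes with $2,3\in P$. Let $K$ be the isomorphism class of a cubic number field unramified outside $P$, and let $j\in T_{3,2,\infty}(\mathbb{Z}^P)^K$. Then every polynomial in $\mathrm{MPolys}_3(P)^K$ with $j$-invariant $j$ is among the polynomials \[ s^{m,n}_{j_0,j_1,j}(t)=\frac{(j-1)\bigl(t(n-m)-n\bigr)^3+(j-1)j\,m^3n^3-j\,(mn-mt+nt-n)^3}{(m-n)^3}, \] where $j_0,j_1\in T_{3,2,\infty}(\mathbb{Z}^P)^K\cup\{0\}$, $m$ runs over the solutions in $\mathbb{Q}\cup\{\infty\}$ of $F(j,j_0,y)=0$, and $n$ runs over the solutions in $\mathbb{Q}\cup\{\infty\}$ of $F(j,j_1,y)=0$. When $m$ and/or $n$ is $\infty$, $s^{m,n}_{j_0,j_1,j}(t)$ is understood in the limiting sense (e.g. $s^{\infty,n}_{j_0,j_1,j}(t)=t^3-3jnt^2+3jn^2t+j(j-2)n^3$).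
   Context: For a finite set of primes $P=\{p_1,\dots,p_r\}$, $P^*$ denotes the set of integers $\pm p_1^{e_1}\cdots p_r^{e_r}$ with $e_i\ge0$, and $\mathbb{Z}^P$ the ring of rationals with denominators in $P^*$. A polynomial in $\mathbb{Z}[t]$ is normalized if its leading coefficient $s(\infty)$ is positive and the gcd of its coefficients is $1$. $\mathrm{Polys}_3(P)$ is the set of irreducible normalized cubic $s(t)\in\mathbb{Z}[t]$ with $\mathrm{Disc}(s)$, $s(0)$, $s(1)$, $s(\infty)$ all in $P^*$; $\mathrm{MPolys}_3(P)=\{s(t)/s(\infty): s\in\mathrm{Polys}_3(P)\}$, and $\mathrm{MPolys}_3(P)^K$ is the subset of those $s$ with $\mathbb{Q}[t]/(s(t))$ in the isomorphism class $K$. The $j$-invariant of a separable monic cubic $t^3+bt^2+ct+d$ is $\frac{4(b^2-3c)^3}{27\Delta(b,c,d)}$, where $\Delta(b,c,d)=-4b^3d+b^2c^2+18bcd-4c^3-27d^2$ is its discriminant. For a rational $j\ne0,1$, write $j=-A/C$ with $A,B,C$ the unique pairwise coprime integers with $A+B+C=0$ and $ABC<0$. $T_{3,2,\infty}(\mathbb{Z}^P)$ is the set of such $j$ with $C\in P^*$, $A=ax^3$ and $B=by^2$ for some $a,b\in P^*$ and integers $x,y$. For such $j$ let $S(j,t)=4(j-1)t^3-27jt-27j$; $T_{3,2,\infty}(\mathbb{Z}^P)^K$ is the set of $j$ for which the algebra $\mathbb{Q}[t]/(S(j,t))$ lies in the class $K$. $F(j,k,y)=k\,(j^2y^3-2jy^3+3jy^2-3jy+1)^2-j\,(jy^2-2y+1)^3$,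 a polynomial of degree at most $6$ in $y$; $\infty$ is counted as a root of $F(j,k,y)$ when its coefficient of $y^6$, namely $j^2(j^2k-j^2-4jk+4k)$, vanishes. *)

theory Defs
  imports "HOL-Algebra.Algebra" "HOL-Algebra.Algebraic_Closure_Type"
begin

definition P_star :: "nat set \<Rightarrow> int set" where
  "P_star P = {z. \<exists>e :: nat \<Rightarrow> nat. z = (\<Prod>p\<in>P. int p ^ e p) \<or> z = - (\<Prod>p\<in>P. int p ^ e p)}"

(* A ring homomorphism from the rationals to a field is unique and injective, so its range is
   the prime field and the characteristic is 0. *)
definition cubic_number_field :: "'k ring \<Rightarrow> bool" where
  "cubic_number_field K \<longleftrightarrow>
     field K \<and>
     (\<exists>\<phi> \<in> ring_hom (ring_of_type_algebra :: rat ring) K.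
        ring.dimension K 3 (range \<phi>) (carrier K))"

(* Polynomials over K are coefficient lists with the leading coefficient first. *)
definition integer_ring :: "'k ring \<Rightarrow> 'k ring" where
  "integer_ring K = K\<lparr>carrier := {x \<in> carrier K.
      \<exists>p. p \<noteq> [] \<and> hd p = \<one>\<^bsub>K\<^esub> \<and>
          set p \<subseteq> range (\<lambda>k :: int. [k] \<cdot>\<^bsub>K\<^esub> \<one>\<^bsub>K\<^esub>) \<and>
          ring.eval K p x = \<zero>\<^bsub>K\<^esub>}\<rparr>"

definition ideal_power :: "'k ring \<Rightarrow> 'k set \<Rightarrow> nat \<Rightarrow> 'k set" where
  "ideal_power R I e = ((\<lambda>J. ideal_prod R I J) ^^ e) (carrier R)"

(* The largest e such that I^e contains, equivalently divides, the principal ideal (p). *)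
definition ramification_index :: "'k ring \<Rightarrow> 'k set \<Rightarrow> nat \<Rightarrow> nat" where
  "ramification_index R I p = (GREATEST e. [p] \<cdot>\<^bsub>R\<^esub> \<one>\<^bsub>R\<^esub> \<in> ideal_power R I e)"

definition unramified_at :: "'k ring \<Rightarrow> nat \<Rightarrow> bool" where
  "unramified_at K p \<longleftrightarrow>
     (\<forall>I. primeideal I (integer_ring K) \<and>
          [p] \<cdot>\<^bsub>integer_ring K\<^esub> \<one>\<^bsub>integer_ring K\<^esub> \<in> I \<longrightarrow>
          ramification_index (integer_ring K) I p = 1)"

(* Only finite primes are constrained; the archimedean place may ramify. *)
definition unramified_outside :: "'k ring \<Rightarrow> nat set \<Rightarrow> bool" where
  "unramified_outside K P \<longleftrightarrow>
     (\<forall>p :: nat. Factorial_Ring.prime p \<and> p \<notin> P \<longrightarrow> unramified_at K p)"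

definition Q_quot :: "rat poly \<Rightarrow> rat poly set ring" where
  "Q_quot s = ring_of_type_algebra Quot (PIdl\<^bsub>ring_of_type_algebra\<^esub> s)"

(* The isomorphism class is given by a representative K.  Ring isomorphisms between
   Q-algebras are automatically Q-linear. *)
definition in_class :: "rat poly \<Rightarrow> 'k ring \<Rightarrow> bool" where
  "in_class s K \<longleftrightarrow> Q_quot s \<simeq> K"

definition disc_cubic :: "'a :: comm_ring_1 poly \<Rightarrow> 'a" where
  "disc_cubic s =
     (let a = Polynomial.coeff s 3; b = Polynomial.coeff s 2;
          c = Polynomial.coeff s 1; d = Polynomial.coeff s 0
      in - 4 * b^3 * d + b^2 * c^2 + 18 * a * b * c * d - 4 * a * c^3 - 27 * a^2 * d^2)"

definition Polys3 :: "nat set \<Rightarrow> int poly set" where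
  "Polys3 P = {s. Polynomial.degree s = 3 \<and> Factorial_Ring.irreducible s \<and>
     Polynomial.lead_coeff s > 0 \<and> Polynomial.content s = 1 \<and>
     disc_cubic s \<in> P_star P \<and> poly s 0 \<in> P_star P \<and> poly s 1 \<in> P_star P \<and>
     Polynomial.lead_coeff s \<in> P_star P}"

definition MPolys3 :: "nat set \<Rightarrow> rat poly set" where
  "MPolys3 P =
     (\<lambda>s. Polynomial.smult (1 / of_int (Polynomial.lead_coeff s)) (map_poly of_int s)) ` Polys3 P"

definition MPolys3_class :: "nat set \<Rightarrow> 'k ring \<Rightarrow> rat poly set" where
  "MPolys3_class P K = {s \<in> MPolys3 P. in_class s K}"

(* Meant for monic separable cubics. *)
definition j_invariant :: "rat poly \<Rightarrow> rat" where
  "j_invariant s =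
     4 * ((Polynomial.coeff s 2)^2 - 3 * Polynomial.coeff s 1)^3 / (27 * disc_cubic s)"

definition T32inf :: "nat set \<Rightarrow> rat set" where
  "T32inf P = {j. j \<noteq> 0 \<and> j \<noteq> 1 \<and>
     (\<exists>A B C :: int. coprime A B \<and> coprime A C \<and> coprime B C \<and>
        A + B + C = 0 \<and> A * B * C < 0 \<and> j = - (of_int A / of_int C) \<and>
        C \<in> P_star P \<and>
        (\<exists>a \<in> P_star P. \<exists>x. A = a * x^3) \<and>
        (\<exists>b \<in> P_star P. \<exists>y. B = b * y^2))}"

definition S_poly :: "rat \<Rightarrow> rat poly" where
  "S_poly j = [: - 27 * j, - 27 * j, 0, 4 * (j - 1) :]"

definition T32inf_class :: "nat set \<Rightarrow> 'k ring \<Rightarrow> rat set" where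
  "T32inf_class P K = {j \<in> T32inf P. in_class (S_poly j) K}"

datatype proj_rat = Fin rat | Infty

definition F :: "rat \<Rightarrow> rat \<Rightarrow> rat \<Rightarrow> rat" where
  "F j k y = k * (j^2 * y^3 - 2 * j * y^3 + 3 * j * y^2 - 3 * j * y + 1)^2
             - j * (j * y^2 - 2 * y + 1)^3"

fun F_root :: "rat \<Rightarrow> rat \<Rightarrow> proj_rat \<Rightarrow> bool" where
  "F_root j k (Fin y) \<longleftrightarrow> F j k y = 0"
| "F_root j k Infty \<longleftrightarrow> j^2 * (j^2 * k - j^2 - 4 * j * k + 4 * k) = 0"

(* The second and third equations are the coefficientwise limits of the first as m, respectively
   n, tends to infinity: divide its numerator and denominator by m^3, respectively n^3.
   The expression is not defined for m = n; the values there are arbitrary. *)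
fun s_poly :: "rat \<Rightarrow> proj_rat \<Rightarrow> proj_rat \<Rightarrow> rat poly" where
  "s_poly j (Fin m) (Fin n) =
     Polynomial.smult (1 / (m - n)^3)
       (Polynomial.smult (j - 1) ([: - n, n - m :]^3)
        + [: (j - 1) * j * m^3 * n^3 :]
        - Polynomial.smult j ([: m * n - n, n - m :]^3))"
| "s_poly j Infty (Fin n) = [: j * (j - 2) * n^3, 3 * j * n^2, - 3 * j * n, 1 :]"
| "s_poly j (Fin m) Infty =
     Polynomial.smult j ([: m - 1, 1 :]^3) - Polynomial.smult (j - 1) ([: - 1, 1 :]^3)
     - [: (j - 1) * j * m^3 :]"
| "s_poly j Infty Infty = 0"

end

(* A cubic s = a t^3 + b t^2 + c t + d with invariant j different from 0 and 1 is affinely equivalent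
   to g(w) = w^3 - 3 j w^2 + 3 j w + j (j - 2). If t = 0 and t = 1 correspond to w = 1/m and w = 1/n,
   then s is recovered from j, m and n by this affine change of variable, which is the formula for
   s^{m,n}. On the other hand F(j, k, 1/w) = 0 says k g(w)^2 = j (w^2 - 2 w + j)^3, and classical
   covariant identities show that this holds at w = 1/m for k the j-invariant j0 of the reversed
   polynomial d t^3 + c t^2 + b t + a, and at w = 1/n for the j-invariant j1 of the reversal of
   s(t + 1). The reversals have the same discriminant as s, leading coefficients s(0) and s(1), and
   define the same field, so j0 and j1 lie in T^K or vanish; membership comes from the syzygy
   4 H^3 = U^2 + 27 a^2 D, divided by the common factors of its terms. *)
theory Submission
  imports Defs
begin

section \<open>Number fields realized as subrings of the complex numbers\<close>

abbreviation eval_at :: "complex \<Rightarrow> rat poly \<Rightarrow> complex" where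
  "eval_at \<alpha> f \<equiv> poly (map_poly of_rat f) \<alpha>"

lemma map_poly_of_rat_add: "map_poly (of_rat :: rat \<Rightarrow> complex) (p + q) = map_poly of_rat p + map_poly of_rat q"
  by (rule poly_eqI) (simp add: coeff_map_poly of_rat_add)

lemma eval_at_mult: "eval_at \<alpha> (p * q) = eval_at \<alpha> p * eval_at \<alpha> q"
proof -
  have "map_poly (of_rat :: rat \<Rightarrow> complex) (p * q) = map_poly of_rat p * map_poly of_rat q"
    by (rule poly_eqI) (simp add: coeff_map_poly coeff_mult of_rat_sum of_rat_mult)
  then show ?thesis by simp
qed

lemma eval_at_pCons [simp]: "eval_at \<alpha> (pCons c p) = of_rat c + \<alpha> * eval_at \<alpha> p"
  by (cases "c = 0 \<and> p = 0") (auto simp: map_poly_pCons)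

text \<open>The degrees of two factors add up to 3, so if neither is constant, one is linear and
  supplies a rational root.\<close>

lemma irreducible_cubic:
  fixes p :: "rat poly"
  assumes "Polynomial.degree p = 3" and "\<And>x. poly p x \<noteq> 0"
  shows "Factorial_Ring.irreducible p"
proof (rule Factorial_Ring.irreducibleI)
  show "p \<noteq> 0" using assms by auto
  show "\<not> p dvd 1" using assms(1) by (subst is_unit_iff_degree) auto
next
  fix a b assume ab: "p = a * b"
  have nz: "a \<noteq> 0" "b \<noteq> 0" using ab assms(1) by auto
  have deg: "Polynomial.degree a + Polynomial.degree b = 3"
    using ab assms(1) nz by (simp add: degree_mult_eq)
  have no_linear: "Polynomial.degree q \<noteq> 1" if "q dvd p" for q
  proof
    assume "Polynomial.degree q = 1"
    then obtain u v where q: "q = [:u, v:]" "v \<noteq> 0"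
      using degree1_coeffs by metis
    then have "poly q (- u / v) = 0" by simp
    then have "poly p (- u / v) = 0" using that by (auto elim: dvdE)
    then show False using assms(2) by blast
  qed
  have "Polynomial.degree a \<noteq> 1" "Polynomial.degree b \<noteq> 1"
    using no_linear[of a] no_linear[of b] ab by simp_all
  then have "Polynomial.degree a = 0 \<or> Polynomial.degree b = 0" using deg by arith
  then show "a dvd 1 \<or> b dvd 1" using nz by (auto simp: is_unit_iff_degree)
qed

text \<open>An irreducible \<open>p\<close> that does not divide \<open>f\<close> is coprime to it,
  and a Bezout relation evaluated at the common root \<open>\<alpha>\<close> would read 0 =
  1.\<close>

lemma eval_at_eq_0_iff_dvd:
  fixes p :: "rat poly"
  assumes "Factorial_Ring.irreducible p" and "eval_at \<alpha> p = 0"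
  shows "eval_at \<alpha> f = 0 \<longleftrightarrow> p dvd f"
proof
  assume "p dvd f"
  then show "eval_at \<alpha> f = 0" using assms(2) by (auto elim!: dvdE simp: eval_at_mult)
next
  assume f: "eval_at \<alpha> f = 0"
  show "p dvd f"
  proof (rule ccontr)
    assume "\<not> p dvd f"
    with assms(1) have "Rings.coprime p f"
      by (intro prime_elem_imp_coprime irreducible_imp_prime_elem)
    then have "gcd p f = 1" by simp
    then have "fst (bezout_coefficients p f) * p + snd (bezout_coefficients p f) * f = 1"
      by (metis bezout_coefficients_fst_snd)
    then have "eval_at \<alpha> (fst (bezout_coefficients p f) * p + snd (bezout_coefficients p f) * f) = 1"
      by simp
    then show False using f assms(2) by (simp add: map_poly_of_rat_add eval_at_mult)
  qed
qed

lemma eval_at_ring_hom: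
  "ring_hom_ring (ring_of_type_algebra :: rat poly ring) (ring_of_type_algebra :: complex ring) (eval_at \<alpha>)"
proof (rule ring_hom_ringI)
  show "ring (ring_of_type_algebra :: rat poly ring)" "ring (ring_of_type_algebra :: complex ring)"
    by (rule ring_from_type_algebra)+
qed (auto simp: ring_of_type_algebra_def map_poly_of_rat_add eval_at_mult)

lemma a_kernel_eval_at:
  "a_kernel ring_of_type_algebra ring_of_type_algebra (eval_at \<alpha>) = {f. eval_at \<alpha> f = 0}"
  by (simp add: a_kernel_def' ring_of_type_algebra_def)

lemma PIdl_type_algebra:
  "PIdl\<^bsub>ring_of_type_algebra\<^esub> (p :: rat poly) = {f. p dvd f}"
  by (auto simp: cgenideal_def ring_of_type_algebra_def)

text \<open>First isomorphism theorem: \<open>p\<close> generates the kernel of evaluation at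
  \<open>\<alpha>\<close>. Quotients by different polynomials thus become subrings of one field and
  can be compared as sets.\<close>

lemma Q_quot_iso_image:
  assumes "Factorial_Ring.irreducible p" and "eval_at \<alpha> p = 0"
  shows "Q_quot p \<simeq> (ring_of_type_algebra :: complex ring)\<lparr>carrier := range (eval_at \<alpha>)\<rparr>"
proof -
  interpret h: ring_hom_ring "ring_of_type_algebra :: rat poly ring"
    "ring_of_type_algebra :: complex ring" "eval_at \<alpha>" by (rule eval_at_ring_hom)
  have "PIdl\<^bsub>ring_of_type_algebra\<^esub> p =
        a_kernel ring_of_type_algebra ring_of_type_algebra (eval_at \<alpha>)"
    unfolding PIdl_type_algebra a_kernel_eval_at eval_at_eq_0_iff_dvd[OF assms] ..
  moreover have "carrier (ring_of_type_algebra :: rat poly ring) = UNIV"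
    by (simp add: ring_of_type_algebra_def)
  ultimately show ?thesis
    using h.FactRing_iso_set_aux by (auto simp: Q_quot_def is_ring_iso_def)
qed

lemma eval_at_pcompose: "eval_at \<alpha> (pcompose f q) = eval_at (eval_at \<alpha> q) f"
  by (induction f) (auto simp: pcompose_pCons map_poly_of_rat_add eval_at_mult)

lemma range_eval_at_mono:
  assumes "\<beta> = eval_at \<alpha> q"
  shows "range (eval_at \<beta>) \<subseteq> range (eval_at \<alpha>)"
proof clarify
  fix f
  have "eval_at \<beta> f = eval_at \<alpha> (pcompose f q)"
    by (simp add: assms eval_at_pcompose)
  then show "eval_at \<beta> f \<in> range (eval_at \<alpha>)" by blast
qed

lemma ring_Q_quot: "ring (Q_quot p)"
proof -
  interpret cring "ring_of_type_algebra :: rat poly ring" by (rule cring_from_type_algebra)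
  have "ideal (PIdl\<^bsub>ring_of_type_algebra\<^esub> p) ring_of_type_algebra"
    by (rule cgenideal_ideal) (simp add: ring_of_type_algebra_def)
  then show ?thesis unfolding Q_quot_def by (rule ideal.quotient_is_ring)
qed

text \<open>Roots that are polynomials in each other generate the same subring of the complex
  numbers, and both quotients are isomorphic to it.\<close>

lemma in_class_transfer:
  assumes "in_class p K"
    and "Factorial_Ring.irreducible p" "Factorial_Ring.irreducible q"
    and "eval_at \<alpha> p = 0" "eval_at \<beta> q = 0"
    and "\<beta> = eval_at \<alpha> f" "\<alpha> = eval_at \<beta> g"
  shows "in_class q K"
proof -
  have "range (eval_at \<alpha>) = range (eval_at \<beta>)"
    using range_eval_at_mono assms(6,7) by blast
  then have "Q_quot p \<simeq> (ring_of_type_algebra :: complex ring)\<lparr>carrier := range (eval_at \<beta>)\<rparr>"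
    using Q_quot_iso_image[OF assms(2,4)] by simp
  from ring_iso_trans[OF this
      ring_iso_sym[OF ring_Q_quot Q_quot_iso_image[OF assms(3,5)]]]
  have "Q_quot p \<simeq> Q_quot q" .
  from ring_iso_trans[OF ring_iso_sym[OF ring_Q_quot this]] assms(1) show ?thesis
    unfolding in_class_def .
qed

section \<open>Integers composed of primes in \<open>P\<close>, and membership in
  \<open>T32inf\<close>\<close>

text \<open>Prime factorization replaces the exponents by a condition on prime divisors, from which
  closure under products and divisors is immediate.\<close>

lemma P_star_iff:
  assumes "finite P" and primes: "\<forall>p\<in>P. Factorial_Ring.prime p"
  shows "z \<in> P_star P \<longleftrightarrow> z \<noteq> 0 \<and> (\<forall>q. Factorial_Ring.prime q \<and> int q dvd z \<longrightarrow> q \<in> P)"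
proof
  assume "z \<in> P_star P"
  then obtain e where e: "z = (\<Prod>p\<in>P. int p ^ e p) \<or> z = - (\<Prod>p\<in>P. int p ^ e p)"
    unfolding P_star_def by blast
  have "0 \<notin> P" using primes not_prime_0 by blast
  then have "z \<noteq> 0" using e assms(1) by auto
  moreover have "q \<in> P" if q: "Factorial_Ring.prime q" "int q dvd z" for q
  proof -
    have "int q dvd (\<Prod>p\<in>P. int p ^ e p)" using q e by auto
    then obtain p where p: "p \<in> P" "int q dvd int p ^ e p"
      using q assms by (subst (asm) prime_dvd_prod_iff) auto
    then have "q dvd p"
      using q(1) by (meson int_dvd_int_iff prime_dvd_power prime_nat_int_transfer)
    then have "q = p" using p(1) primes q(1) primes_dvd_imp_eq by blast
    then show ?thesis using p(1) by simp
  qed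
  ultimately show "z \<noteq> 0 \<and> (\<forall>q. Factorial_Ring.prime q \<and> int q dvd z \<longrightarrow> q \<in> P)" by blast
next
  assume z: "z \<noteq> 0 \<and> (\<forall>q. Factorial_Ring.prime q \<and> int q dvd z \<longrightarrow> q \<in> P)"
  define n where "n = nat \<bar>z\<bar>"
  have "n \<noteq> 0" using z by (simp add: n_def)
  have "prime_factors n \<subseteq> P"
  proof
    fix q assume "q \<in> prime_factors n"
    then have "Factorial_Ring.prime q" "int q dvd int n" by auto
    then show "q \<in> P" using z by (simp add: n_def)
  qed
  have "n = (\<Prod>p\<in>prime_factors n. p ^ Factorial_Ring.multiplicity p n)"
    using \<open>n \<noteq> 0\<close> by (simp add: prime_factorization_nat[symmetric])
  \<comment> \<open>Primes of \<open>P\<close> that do not divide \<open>n\<close> enter with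
    exponent 0.\<close>
  also have "\<dots> = (\<Prod>p\<in>P. p ^ Factorial_Ring.multiplicity p n)"
    using assms \<open>prime_factors n \<subseteq> P\<close>
    by (intro prod.mono_neutral_left)
      (auto simp: prime_factors_multiplicity not_dvd_imp_multiplicity_0)
  finally have "int n = int (\<Prod>p\<in>P. p ^ Factorial_Ring.multiplicity p n)" by (rule arg_cong)
  moreover have "int n = \<bar>z\<bar>" by (simp add: n_def)
  ultimately have "\<bar>z\<bar> = (\<Prod>p\<in>P. int p ^ Factorial_Ring.multiplicity p n)"
    by (simp only: of_nat_prod of_nat_power)
  then have "z = (\<Prod>p\<in>P. int p ^ Factorial_Ring.multiplicity p n) \<or>
             z = - (\<Prod>p\<in>P. int p ^ Factorial_Ring.multiplicity p n)"
    by linarith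
  then show "z \<in> P_star P" unfolding P_star_def by (intro CollectI exI)
qed

context
  fixes P :: "nat set"
  assumes fin: "finite P" and primes: "\<forall>p\<in>P. Factorial_Ring.prime p"
begin

lemma P_star_dvd: "x \<in> P_star P \<Longrightarrow> y dvd x \<Longrightarrow> y \<in> P_star P"
  unfolding P_star_iff[OF fin primes] by (metis dvd_0_left dvd_trans)

lemma P_star_mult: "x \<in> P_star P \<Longrightarrow> y \<in> P_star P \<Longrightarrow> x * y \<in> P_star P"
  unfolding P_star_iff[OF fin primes]
  by (metis mult_eq_0_iff prime_dvd_mult_iff prime_nat_int_transfer)

lemma P_star_1: "1 \<in> P_star P"
  unfolding P_star_iff[OF fin primes] by auto

lemma P_star_power: "x \<in> P_star P \<Longrightarrow> x ^ k \<in> P_star P"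
  by (induction k) (auto intro: P_star_mult P_star_1)

lemma P_star_minus: "x \<in> P_star P \<Longrightarrow> - x \<in> P_star P"
  unfolding P_star_iff[OF fin primes] by auto

lemma P_star_prime: "p \<in> P \<Longrightarrow> int p \<in> P_star P"
  unfolding P_star_iff[OF fin primes]
  using primes by (auto dest: primes_dvd_imp_eq prime_gt_0_nat)

text \<open>The primes of \<open>P\<close> are divided out one at a time; the absolute value drops
  each time, so this ends.\<close>

lemma P_star_split:
  fixes h :: int
  assumes "h \<noteq> 0"
  obtains g x where "g \<in> P_star P" "h = g * x" "\<forall>p\<in>P. \<not> int p dvd x"
proof -
  have "\<exists>g x. g \<in> P_star P \<and> h = g * x \<and> (\<forall>p\<in>P. \<not> int p dvd x)"
    using assms
  proof (induction "nat \<bar>h\<bar>" arbitrary: h rule: less_induct)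
    case less
    show ?case
    proof (cases "\<exists>p\<in>P. int p dvd h")
      case False
      then show ?thesis using P_star_1 by (metis mult_1)
    next
      case True
      then obtain p h' where p: "p \<in> P" and h: "h = int p * h'" unfolding dvd_def by blast
      have "p > 1" using p primes prime_gt_1_nat by blast
      moreover have "h' \<noteq> 0" using h less.prems by auto
      ultimately have "nat \<bar>h'\<bar> < nat \<bar>h\<bar>" by (simp add: h abs_mult)
      from less.hyps[OF this \<open>h' \<noteq> 0\<close>] obtain g x where
        "g \<in> P_star P" "h' = g * x" "\<forall>p\<in>P. \<not> int p dvd x" by blast
      then show ?thesis using h P_star_mult[OF P_star_prime[OF p]] by (metis mult.assoc)
    qed
  qed
  then show ?thesis using that by blast
qed

text \<open>A common prime factor would lie in \<open>P\<close> as a divisor of \<open>g\<close>,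
  but no prime of \<open>P\<close> divides \<open>x\<close>.\<close>

lemma P_star_coprime:
  assumes "g \<in> P_star P" and "\<forall>p\<in>P. \<not> int p dvd x"
  shows "coprime x g"
proof (rule ccontr)
  assume "\<not> coprime x g"
  moreover have "g \<noteq> 0" using assms(1) P_star_iff[OF fin primes] by blast
  ultimately obtain e where e: "e dvd x" "e dvd g" "\<not> is_unit e" "e \<noteq> 0"
    by (metis not_coprimeE dvd_0_left)
  then obtain q where "Factorial_Ring.prime q" "q dvd e" using prime_divisor_exists by blast
  with e have q: "Factorial_Ring.prime q" "q dvd x" "q dvd g" by (auto intro: dvd_trans)
  then obtain p where "q = int p" using prime_ge_0_int nonneg_int_cases by blast
  with q assms P_star_iff[OF fin primes] show False by auto
qed

text \<open>Since \<open>h = h1 * x\<close> with \<open>h1\<close> in \<open>P*\<close> and \<open>x\<close> prime to \<open>P\<close>, the factor \<open>x ^ k\<close> survives the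
  division by \<open>g\<close>.\<close>
lemma P_star_times_power:
  fixes h :: int
  assumes "h \<noteq> 0" "g \<in> P_star P" "m \<in> P_star P" and eq: "A * g = m * h ^ k"
  obtains a x where "a \<in> P_star P" "A = a * x ^ k"
proof -
  obtain h1 x where h: "h1 \<in> P_star P" "h = h1 * x" "\<forall>p\<in>P. \<not> int p dvd x"
    using P_star_split[OF assms(1)] by blast
  have "coprime (x ^ k) g" using P_star_coprime[OF assms(2) h(3)] by simp
  moreover have "x ^ k dvd A * g" by (simp add: eq h(2) power_mult_distrib)
  ultimately have "x ^ k dvd A" by (simp add: coprime_dvd_mult_left_iff)
  then obtain a where a: "A = a * x ^ k" by (metis dvdE mult.commute)
  have "a * g * x ^ k = m * h1 ^ k * x ^ k"
    using eq by (simp add: a h(2) power_mult_distrib algebra_simps)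
  moreover have "x \<noteq> 0" using assms(1) h(2) by auto
  ultimately have "a * g = m * h1 ^ k" by simp
  moreover have "m * h1 ^ k \<in> P_star P" using assms(3) h(1) P_star_mult P_star_power by blast
  ultimately have "a \<in> P_star P" using P_star_dvd by (metis dvd_triv_left)
  then show ?thesis using that a by blast
qed

text \<open>Division by the gcd \<open>g\<close> of \<open>4 * h^3\<close> and \<open>u^2\<close>
  makes the three terms pairwise coprime. As \<open>g\<close> also divides \<open>27 * c\<close>, it
  lies in \<open>P_star P\<close>, so the quotients \<open>A\<close> and \<open>B\<close> are still
  a cube and a square up to factors from \<open>P_star P\<close>.\<close>

lemma T32inf_memI:
  fixes h u c :: int
  assumes "2 \<in> P" "3 \<in> P" and eq: "4 * h^3 = u^2 + 27 * c"
    and nz: "h \<noteq> 0" "u \<noteq> 0" and c: "c \<in> P_star P"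
  shows "4 * of_int h ^ 3 / (27 * of_int c) \<in> T32inf P"
proof -
  have c0: "c \<noteq> 0" using c P_star_iff[OF fin primes] by blast
  have four: "4 \<in> P_star P"
    using P_star_power[OF P_star_prime[OF assms(1)], of 2] by simp
  have tw: "27 \<in> P_star P"
    using P_star_power[OF P_star_prime[OF assms(2)], of 3] by simp
  have C0: "27 * c \<in> P_star P" by (intro P_star_mult tw c)
  define g where "g = gcd (4 * h^3) (u^2)"
  have g0: "g \<noteq> 0" using nz by (simp add: g_def)
  obtain A B where A: "4 * h^3 = A * g" and B: "u^2 = B * g" and cop: "coprime A B"
    using nz gcd_coprime_exists[of "4 * h^3" "u^2"] unfolding g_def by auto
  have C: "27 * c = (A - B) * g" using eq A B by (simp add: algebra_simps)
  have gP: "g \<in> P_star P" using P_star_dvd[OF C0] C by simp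
  have CP: "A - B \<in> P_star P" using P_star_dvd[OF C0] C by simp
  obtain a x where a: "a \<in> P_star P" "A = a * x^3"
    using P_star_times_power[OF nz(1) gP four A[symmetric]] by blast
  have "B * g = 1 * u^2" using B by simp
  then obtain b y where b: "b \<in> P_star P" "B = b * y^2"
    using P_star_times_power[OF nz(2) gP P_star_1] by blast
  have "e dvd B" if "e dvd A" "e dvd A - B" for e
    using dvd_diff[OF that] by simp
  then have cop1: "coprime A (A - B)"
    using cop by (meson coprime_def)
  have "e dvd A" if "e dvd B" "e dvd A - B" for e
    using dvd_add[OF that] by simp
  then have "coprime B (A - B)"
    using cop by (meson coprime_def)
  note cop' = cop1 this
  have nz': "A \<noteq> 0" "B \<noteq> 0" "A - B \<noteq> 0" using A B C nz c0 by auto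
  define j :: rat where "j = 4 * of_int h ^ 3 / (27 * of_int c)"
  have j: "j = of_int A / of_int (A - B)"
  proof -
    have "4 * of_int h ^ 3 = (of_int A * of_int g :: rat)"
      using A by (metis of_int_mult of_int_power of_int_numeral)
    moreover have "27 * of_int c = (of_int (A - B) * of_int g :: rat)"
      using C by (metis of_int_mult of_int_numeral)
    ultimately show ?thesis using g0 by (simp add: j_def)
  qed
  have "j \<noteq> 0" using j nz' by simp
  moreover have "j \<noteq> 1" using j nz' by (auto simp: field_simps)
  moreover have "\<exists>A B C :: int. coprime A B \<and> coprime A C \<and> coprime B C \<and>
        A + B + C = 0 \<and> A * B * C < 0 \<and> j = - (of_int A / of_int C) \<and>
        C \<in> P_star P \<and> (\<exists>a \<in> P_star P. \<exists>x. A = a * x^3) \<and> (\<exists>b \<in> P_star P. \<exists>y. B = b * y^2)"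
  \<comment> \<open>The value of \<open>j\<close> fixes the coprime triple up to a common sign; of
    \<open>(- A, B, A - B)\<close> and its negative, the one with negative product is taken.\<close>
  proof (cases "0 < A * B * (A - B)")
    case True
    then have neg: "- A * B * (A - B) < 0" by simp
    have rep: "- A = - a * x^3" "B = b * y^2" using a b by simp_all
    have "j = - (of_int (- A) / of_int (A - B))" using j by simp
    moreover have "- A + B + (A - B) = 0" "coprime (- A) B" "coprime (- A) (A - B)"
      using cop cop' by simp_all
    ultimately show ?thesis
      using neg cop' CP rep P_star_minus[OF a(1)] b(1) by blast
  next
    case False
    then have neg: "A * (- B) * (- (A - B)) < 0"
      using nz' by (metis linorder_neqE mult_eq_0_iff mult_minus_left mult_minus_right minus_minus)
    have rep: "A = a * x^3" "- B = - b * y^2" using a b by simp_all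
    have "j = - (of_int A / of_int (- (A - B)))" using j by (simp only: of_int_minus minus_divide_right minus_minus)
    moreover have "A + - B + - (A - B) = 0" "coprime A (- B)" "coprime A (- (A - B))"
      "coprime (- B) (- (A - B))"
      using cop cop' by (simp_all only: coprime_minus_left_iff coprime_minus_right_iff)
    ultimately show ?thesis
      using neg P_star_minus[OF CP] rep a(1) P_star_minus[OF b(1)] by blast
  qed
  ultimately show ?thesis unfolding T32inf_def j_def by blast
qed

end

section \<open>Rational roots of cubics, and fields under changes of variable\<close>

lemma cubic_eq_coeffs:
  assumes "Polynomial.degree p = 3"
  shows "p = [:Polynomial.coeff p 0, Polynomial.coeff p 1, Polynomial.coeff p 2, Polynomial.coeff p 3:]"
proof (rule poly_eqI)
  fix n
  consider "n = 0" | "n = 1" | "n = 2" | "n = 3" | m where "n = Suc (Suc (Suc (Suc m)))"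
    by (metis One_nat_def Suc_1 numeral_3_eq_3 not0_implies_Suc)
  then show "Polynomial.coeff p n = Polynomial.coeff
    [:Polynomial.coeff p 0, Polynomial.coeff p 1, Polynomial.coeff p 2, Polynomial.coeff p 3:] n"
    by cases (use assms in \<open>auto simp: numeral_2_eq_2 numeral_3_eq_3 coeff_eq_0\<close>)
qed

text \<open>For a root \<open>u / v\<close> in lowest terms, repeated division by \<open>v\<close> as in Horner's scheme yields an
  integral cofactor of \<open>v t - u\<close>.\<close>
lemma irreducible_int_cubic_no_rat_root:
  fixes s :: "int poly"
  assumes "Factorial_Ring.irreducible s" "Polynomial.degree s = 3"
  shows "poly (map_poly of_int s) (r :: rat) \<noteq> 0"
proof
  assume root: "poly (map_poly of_int s) r = 0"
  obtain u v where r: "r = of_int u / of_int v" "v > 0" "coprime u v"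
    by (metis Fract_of_int_quotient Rat_cases)
  obtain d c b a where s: "s = [:d, c, b, a:]"
    using cubic_eq_coeffs[OF assms(2)] by blast
  have a0: "a \<noteq> 0" using assms(2) s by (auto split: if_splits)
  have "of_int d + r * (of_int c + r * (of_int b + r * of_int a)) = 0"
    using root a0 by (simp add: s map_poly_pCons)
  note root' = this
  have ru: "of_int u = r * of_int v" using r(2) by (simp add: r(1))
  \<comment> \<open>The root equation times \<open>v^3\<close>: the \<open>0\<close> on the right is
    rewritten backwards into the value at \<open>r\<close>, which leaves a ring identity.\<close>
  have "of_int a * of_int u^3 + of_int b * of_int u^2 * of_int v
      + of_int c * of_int u * of_int v^2 + of_int d * of_int v^3 
    = of_int v^3 * (0 :: rat)"
    unfolding ru root'[symmetric] by (simp add: power3_eq_cube power2_eq_square algebra_simps)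
  then have "of_int (a * u^3 + b * u^2 * v + c * u * v^2 + d * v^3) = (0 :: rat)"
    by (simp only: of_int_add of_int_mult of_int_power mult_zero_right)
  then have e: "a * u^3 + b * u^2 * v + c * u * v^2 + d * v^3 = 0" by (simp only: of_int_eq_0_iff)
  have "v dvd a * u^3"
  proof -
    have "a * u^3 = v * (- (b * u^2 + c * u * v + d * v^2))"
      using e by (simp add: power2_eq_square power3_eq_cube algebra_simps)
    then show ?thesis by simp
  qed
  then have "v dvd a" using r(3) by (simp add: coprime_dvd_mult_left_iff coprime_commute)
  then obtain a1 where a1: "a = v * a1" by (elim dvdE)
  have e1: "a1 * u^3 + b * u^2 + c * u * v + d * v^2 = 0"
  proof -
    have "v * (a1 * u^3 + b * u^2 + c * u * v + d * v^2) = 0" using e unfolding a1 by (simp add: power2_eq_square power3_eq_cube algebra_simps)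
    then show ?thesis using r(2) by simp
  qed
  have "v dvd (a1 * u + b) * u^2"
  proof -
    have "(a1 * u + b) * u^2 = v * (- (c * u + d * v))"
      using e1 by (simp add: power2_eq_square power3_eq_cube algebra_simps)
    then show ?thesis by simp
  qed
  then have "v dvd a1 * u + b" using r(3) by (simp add: coprime_dvd_mult_left_iff coprime_commute)
  then obtain b1 where b1: "a1 * u + b = v * b1" by (elim dvdE)
  have e2: "b1 * u^2 + c * u + d * v = 0"
  proof -
    have "v * (b1 * u^2 + c * u + d * v) = (v * b1) * u^2 + c * u * v + d * v^2"
      by (simp add: power2_eq_square algebra_simps)
    also have "\<dots> = 0" unfolding b1[symmetric]
      using e1 by (simp add: power2_eq_square power3_eq_cube algebra_simps)
    finally have "v * (b1 * u^2 + c * u + d * v) = 0" .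
    then show ?thesis using r(2) by simp
  qed
  have "v dvd (b1 * u + c) * u"
  proof -
    have "(b1 * u + c) * u = v * (- d)"
      using e2 by (simp add: power2_eq_square power3_eq_cube algebra_simps)
    then show ?thesis by simp
  qed
  then have "v dvd b1 * u + c" using r(3) by (simp add: coprime_dvd_mult_left_iff coprime_commute)
  then obtain c1 where c1: "b1 * u + c = v * c1" by (elim dvdE)
  have e3: "c1 * u + d = 0"
  proof -
    have "v * (c1 * u + d) = (v * c1) * u + d * v"
      by (simp add: algebra_simps)
    also have "\<dots> = 0" unfolding c1[symmetric]
      using e2 by (simp add: power2_eq_square power3_eq_cube algebra_simps)
    finally have "v * (c1 * u + d) = 0" .
    then show ?thesis using r(2) by simp
  qed
  \<comment> \<open>These are the coefficients of the product of \<open>v t - u\<close> and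
    \<open>a1 t^2 + b1 t + c1\<close>, neither of which is constant.\<close>
  have "b = v * b1 - u * a1" "c = v * c1 - u * b1" "d = - u * c1"
    using b1 c1 e3 by (simp_all add: algebra_simps)
  then have "s = [:- u, v:] * [:c1, b1, a1:]" using a1 by (simp add: s algebra_simps)
  then have "[:- u, v:] dvd 1 \<or> [:c1, b1, a1:] dvd 1"
    using assms(1) by (meson Factorial_Ring.irreducible_def)
  moreover have "a1 \<noteq> 0" using a0 a1 by auto
  ultimately show False
    using r(2) dvd_imp_degree_le[of "[:- u, v:]" 1] dvd_imp_degree_le[of "[:c1, b1, a1:]" 1]
    by auto
qed

text \<open>If \<open>\<alpha>\<close> is a complex root of \<open>p\<close>, then
  \<open>u + v \<alpha>\<close> is a root of \<open>q\<close>, and this affine map has an inverse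
  over the rationals.\<close>

lemma in_class_of_pcompose_linear:
  fixes p q :: "rat poly"
  assumes "in_class p K" and "Polynomial.degree p = 3" "\<And>x. poly p x \<noteq> 0"
    and "Polynomial.degree q = 3" and comp: "pcompose q [:u, v:] = Polynomial.smult M p"
    and "v \<noteq> 0"
  shows "in_class q K"
proof -
  have "Polynomial.degree (map_poly of_rat p :: complex poly) = 3"
    using assms(2) by (simp add: degree_map_poly)
  then obtain \<alpha> where \<alpha>: "eval_at \<alpha> p = 0"
    using fundamental_theorem_of_algebra[of "map_poly of_rat p :: complex poly"]
    by (metis constant_degree zero_neq_numeral)
  define \<beta> where "\<beta> = eval_at \<alpha> [:u, v:]"
  have "Polynomial.smult M p = [:M:] * p" by simp
  then have "eval_at \<beta> q = 0"
    unfolding \<beta>_def eval_at_pcompose[symmetric] comp by (simp only: eval_at_mult \<alpha> mult_zero_right)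
  moreover have "\<alpha> = eval_at \<beta> [:- u / v, 1 / v:]"
  proof -
    have "of_rat v \<noteq> (0 :: complex)" using assms(6) by simp
    moreover have "\<beta> = of_rat u + \<alpha> * of_rat v" by (simp add: \<beta>_def)
    moreover have "eval_at \<beta> [:- u / v, 1 / v:] = (\<beta> - of_rat u) / of_rat v"
      by (simp add: of_rat_divide of_rat_minus diff_divide_distrib)
    ultimately show ?thesis by simp
  qed
  moreover have "poly q x \<noteq> 0" for x
  proof
    assume "poly q x = 0"
    moreover have "poly q x = poly (pcompose q [:u, v:]) ((x - u) / v)"
      using assms(6) by (simp add: poly_pcompose)
    ultimately have "M * poly p ((x - u) / v) = 0" by (simp add: comp)
    \<comment> \<open>A nonconstant affine substitution keeps the degree of \<open>q\<close> at
      3.\<close>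
    moreover have "M \<noteq> 0"
      using comp assms(4,6) by (metis degree_pcompose degree_pCons_eq_if degree_0 mult_1_right One_nat_def
        smult_0_left zero_neq_numeral pCons_eq_0_iff)
    ultimately show False using assms(3) by simp
  qed
  ultimately show ?thesis
    using in_class_transfer[OF assms(1) irreducible_cubic[OF assms(2,3)] irreducible_cubic[OF assms(4)]]
      \<alpha> \<beta>_def by blast
qed

text \<open>Reversal inverts the roots, and the inverse of an algebraic number is a polynomial in
  that number.\<close>

lemma in_class_reversed:
  fixes a b c d :: rat
  assumes "in_class [:d, c, b, a:] K" and "a \<noteq> 0" and nr: "\<And>x. poly [:d, c, b, a:] x \<noteq> 0"
  shows "in_class [:a, b, c, d:] K" and "\<And>x. poly [:a, b, c, d:] x \<noteq> 0"
proof -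
  have d: "d \<noteq> 0" using nr[of 0] by simp
  show nr': "poly [:a, b, c, d:] x \<noteq> 0" for x
  proof
    assume "poly [:a, b, c, d:] x = 0"
    then have e: "a + x * (b + x * (c + x * d)) = 0" by simp
    then have "x \<noteq> 0" using assms(2) by auto
    then have "poly [:d, c, b, a:] (1 / x) = (a + x * (b + x * (c + x * d))) / x^3"
      by (simp add: add_divide_distrib distrib_left power3_eq_cube)
    then have "poly [:d, c, b, a:] (1 / x) = 0" using e by simp
    then show False using nr by blast
  qed
  let ?p = "[:d, c, b, a:]"
  have deg: "Polynomial.degree ?p = 3" "Polynomial.degree [:a, b, c, d:] = 3"
    using assms(2) d by simp_all
  have "Polynomial.degree (map_poly of_rat ?p :: complex poly) = 3"
    using deg(1) by (subst degree_map_poly) simp_all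
  then obtain \<alpha> where \<alpha>: "eval_at \<alpha> ?p = 0"
    using fundamental_theorem_of_algebra[of "map_poly of_rat ?p :: complex poly"]
    by (metis constant_degree zero_neq_numeral)
  have \<alpha>': "of_rat d + \<alpha> * (of_rat c + \<alpha> * (of_rat b + \<alpha> * of_rat a)) = 0"
    using \<alpha> by simp
  have "\<alpha> \<noteq> 0" using \<alpha>' d by auto
  \<comment> \<open>The equation of \<open>\<alpha>\<close>, divided by \<open>d \<alpha>\<close>
    and solved for \<open>1 / \<alpha>\<close>.\<close>
  have inv: "1 / \<alpha> = eval_at \<alpha> [:- c / d, - b / d, - a / d:]"
  proof -
    define Y where "Y = of_rat c + \<alpha> * (of_rat b + \<alpha> * of_rat a)"
    have dX: "of_rat d = - (\<alpha> * Y)" using \<alpha>' by (simp add: Y_def eq_neg_iff_add_eq_0)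
    have "Y \<noteq> 0" using dX d by auto
    have "eval_at \<alpha> [:- c / d, - b / d, - a / d:] = - (Y / of_rat d)"
      by (simp add: Y_def of_rat_divide of_rat_minus add_divide_distrib algebra_simps)
    also have "\<dots> = 1 / \<alpha>"
      unfolding dX using \<open>Y \<noteq> 0\<close> \<open>\<alpha> \<noteq> 0\<close> by simp
    finally show ?thesis by simp
  qed
  have "of_rat a + (1 / \<alpha>) * (of_rat b + (1 / \<alpha>) * (of_rat c + (1 / \<alpha>) * of_rat d)) =
      (of_rat d + \<alpha> * (of_rat c + \<alpha> * (of_rat b + \<alpha> * of_rat a))) / \<alpha>^3"
    using \<open>\<alpha> \<noteq> 0\<close> by (simp add: add_divide_distrib distrib_left power3_eq_cube)
  then have root: "eval_at (1 / \<alpha>) [:a, b, c, d:] = 0" by (simp add: \<alpha>')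
  \<comment> \<open>The equation of \<open>\<alpha>\<close>, divided by \<open>a \<alpha>^2\<close>
    and solved for \<open>\<alpha>\<close>.\<close>
  have inv': "\<alpha> = eval_at (1 / \<alpha>) [:- b / a, - c / a, - d / a:]"
  proof -
    define Y where "Y = of_rat d + \<alpha> * (of_rat c + \<alpha> * of_rat b)"
    have "Y + of_rat a * \<alpha>^3 = 0"
      using \<alpha>' by (simp add: Y_def algebra_simps power3_eq_cube)
    then have Y: "Y = - (of_rat a * \<alpha>^3)" by (simp add: eq_neg_iff_add_eq_0)
    have "eval_at (1 / \<alpha>) [:- b / a, - c / a, - d / a:] = - (Y / of_rat a) / \<alpha>^2"
      using \<open>\<alpha> \<noteq> 0\<close>
      by (simp add: Y_def of_rat_divide of_rat_minus add_divide_distrib diff_divide_distrib distrib_left power2_eq_square)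
    also have "\<dots> = \<alpha>"
      unfolding Y using assms(2) \<open>\<alpha> \<noteq> 0\<close> by (simp add: power2_eq_square power3_eq_cube)
    finally show ?thesis by simp
  qed
  show "in_class [:a, b, c, d:] K"
    using in_class_transfer[OF assms(1) irreducible_cubic[OF deg(1) nr] irreducible_cubic[OF deg(2) nr']
      \<alpha> root inv inv'] .
qed

section \<open>The syzygy, and the field attached to an invariant\<close>

text \<open>With \<open>H = b^2 - 3 a c\<close>, \<open>U = 2 b^3 - 9 a b c + 27 a^2 d\<close>, \<open>y = 3 a x + b\<close>, completing the cube gives
  \<open>27 a^2 (a x^3 + b x^2 + c x + d) = y^3 - 3 H y + U\<close>.\<close>
lemma cubic_syzygy:
  fixes a b c d :: "'a :: comm_ring_1"
  shows "4 * (b^2 - 3*a * c)^3 = (2*b^3 - 9*a*b * c + 27*a^2*d)^2 + 27 * (a^2 * disc_cubic [:d, c, b, a:])"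
  by (simp add: disc_cubic_def Let_def eval_nat_numeral algebra_simps)

text \<open>The argument of \<open>S_poly\<close> is the j-invariant of the cubic made monic. A
  rational rescaling of \<open>y = 3 a x + b\<close> carries the depressed cubic
  \<open>y^3 - 3 H y + U\<close> to a multiple of \<open>S_poly\<close>.\<close>

lemma in_class_S_poly:
  fixes a b c d :: rat
  defines "H \<equiv> b^2 - 3*a * c" and "U \<equiv> 2*b^3 - 9*a*b * c + 27*a^2*d"
  assumes "in_class [:d, c, b, a:] K" and "a \<noteq> 0" and nr: "\<And>x. poly [:d, c, b, a:] x \<noteq> 0"
    and D: "disc_cubic [:d, c, b, a:] \<noteq> 0" and H: "H \<noteq> 0"
  shows "in_class (S_poly (4 * H^3 / (27 * (a^2 * disc_cubic [:d, c, b, a:])))) K" and "U \<noteq> 0"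
proof -
  define E where "E = a^2 * disc_cubic [:d, c, b, a:]"
  have E0: "E \<noteq> 0" using D assms(4) by (simp add: E_def)
  have syz: "4 * H^3 = U^2 + 27 * E" unfolding H_def U_def E_def by (rule cubic_syzygy)
  have dep: "27 * a^2 * poly [:d, c, b, a:] x = (3*a*x + b)^3 - 3 * H * (3*a*x + b) + U" for x
    by (simp add: H_def U_def eval_nat_numeral algebra_simps)
  \<comment> \<open>Otherwise \<open>y = 0\<close> would be a root of the depressed cubic.\<close>
  show U: "U \<noteq> 0"
  proof
    assume "U = 0"
    moreover have "3 * a * (- b / (3*a)) + b = 0" using assms(4) by simp
    ultimately have "27 * a^2 * poly [:d, c, b, a:] (- b / (3*a)) = 0"
      unfolding dep by (simp only:) simp
    then show False using nr[of "- b / (3*a)"] assms(4)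
      by (metis mult_eq_0_iff power_not_zero zero_neq_numeral)
  qed
  define k where "k = 4 * H^3 / (27 * E)"
  have k1: "k - 1 = U^2 / (27 * E)" using syz E0 by (simp add: k_def field_simps)
  \<comment> \<open>\<open>S_poly k\<close> has equal linear and constant coefficients, so
    \<open>\<kappa>\<close> must be the ratio of those of \<open>y^3 - 3 H y + U\<close>; the cubic
    coefficient then matches by the syzygy.\<close>
  define \<kappa> where "\<kappa> = - 3 * H / U"
  have A: "27 * k * \<kappa> = 4 * (k - 1) * \<kappa>^3 * (3 * H)" "- 27 * k = 4 * (k - 1) * \<kappa>^3 * U"
    unfolding k1 unfolding k_def \<kappa>_def using E0 H U
    by (simp_all add: field_simps power2_eq_square power3_eq_cube)
  have "poly (S_poly k) (\<kappa> * y) = 4 * (k - 1) * \<kappa>^3 * (y^3 - 3 * H * y + U)" for y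
  proof -
    have "poly (S_poly k) (\<kappa> * y) = - 27 * k - (27 * k * \<kappa>) * y + 4 * (k - 1) * \<kappa>^3 * y^3"
      by (simp add: S_poly_def algebra_simps power3_eq_cube)
    then show ?thesis unfolding A by (simp add: algebra_simps)
  qed
  then have "poly (S_poly k) (\<kappa> * (3*a*x + b)) =
      4 * (k - 1) * \<kappa>^3 * (27 * a^2 * poly [:d, c, b, a:] x)" for x
    unfolding dep .
  moreover have "poly [:\<kappa> * b, 3 * a * \<kappa>:] x = \<kappa> * (3*a*x + b)" for x
    by (simp add: algebra_simps)
  ultimately have "poly (pcompose (S_poly k) [:\<kappa> * b, 3 * a * \<kappa>:]) x =
      poly (Polynomial.smult (4 * (k - 1) * \<kappa>^3 * (27 * a^2)) [:d, c, b, a:]) x" for x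
    by (simp only: poly_pcompose poly_smult mult.assoc)
  then have comp: "pcompose (S_poly k) [:\<kappa> * b, 3 * a * \<kappa>:] =
      Polynomial.smult (4 * (k - 1) * \<kappa>^3 * (27 * a^2)) [:d, c, b, a:]"
    by (intro poly_eq_poly_eq_iff[THEN iffD1] ext)
  have "k \<noteq> 1" using k1 U E0 by auto
  then have "Polynomial.degree (S_poly k) = 3" by (simp add: S_poly_def)
  moreover have "3 * a * \<kappa> \<noteq> 0" using assms(4) H U by (simp add: \<kappa>_def)
  ultimately have "in_class (S_poly k) K"
    using in_class_of_pcompose_linear[OF assms(3) _ nr _ comp] assms(4) by simp
  then show "in_class (S_poly (4 * H^3 / (27 * (a^2 * disc_cubic [:d, c, b, a:])))) K"
    by (simp add: k_def E_def)
qed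

lemma T32inf_class_memI:
  fixes a b c d :: int
  defines "D \<equiv> disc_cubic [:d, c, b, a:]"
  assumes "finite P" "\<forall>p\<in>P. Factorial_Ring.prime p" "2 \<in> P" "3 \<in> P"
    and cl: "in_class [:of_int d, of_int c, of_int b, of_int a:] K"
    and nr: "\<And>x :: rat. poly [:of_int d, of_int c, of_int b, of_int a:] x \<noteq> 0"
    and "a \<in> P_star P" "D \<in> P_star P" and H: "b^2 - 3*a * c \<noteq> 0"
  shows "4 * of_int (b^2 - 3*a * c)^3 / (27 * of_int (a^2 * D)) \<in> T32inf_class P K"
proof -
  note Pst = P_star_iff[OF assms(2,3)]
  let ?d = "of_int d :: rat" and ?c = "of_int c :: rat" and ?b = "of_int b :: rat" and ?a = "of_int a :: rat"
  have nz: "?a \<noteq> 0" "D \<noteq> 0" using assms(8,9) Pst by auto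
  have D: "disc_cubic [:?d, ?c, ?b, ?a:] = of_int D"
    by (simp add: D_def disc_cubic_def Let_def eval_nat_numeral)
  have D0: "disc_cubic [:?d, ?c, ?b, ?a:] \<noteq> 0" using nz D by simp
  have H': "?b^2 - 3 * ?a * ?c = of_int (b^2 - 3*a * c)" by simp
  have H0: "?b^2 - 3 * ?a * ?c \<noteq> 0" unfolding H' using H by (simp only: of_int_eq_0_iff not_False_eq_True)
  note S = in_class_S_poly[OF cl nz(1) nr D0 H0]
  have "2*b^3 - 9*a*b * c + 27*a^2*d \<noteq> 0"
    using S(2) by (metis (mono_tags, opaque_lifting) of_int_0 of_int_add of_int_diff of_int_mult of_int_numeral of_int_power)
  moreover have "a^2 * D \<in> P_star P"
    using assms(2,3,8,9) P_star_mult P_star_power by blast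
  ultimately have "4 * of_int (b^2 - 3*a * c)^3 / (27 * of_int (a^2 * D)) \<in> T32inf P"
    using T32inf_memI[OF assms(2-5) cubic_syzygy[of b a c d, folded D_def] H] by blast
  then show ?thesis using S(1) unfolding T32inf_class_def D H' by simp
qed

section \<open>The points m and n as inverse coordinates, and the covariant identities\<close>

text \<open>The roots \<open>m\<close> and \<open>n\<close> are the inverses of the coordinates \<open>w\<close> corresponding to \<open>t = 0\<close> and
  \<open>t = 1\<close>, whence \<open>Infty\<close> at \<open>w = 0\<close>.\<close>
definition proj_inverse :: "rat \<Rightarrow> proj_rat" where
  "proj_inverse w = (if w = 0 then Infty else Fin (1 / w))"

lemma proj_inverse_inject: "proj_inverse v = proj_inverse w \<longleftrightarrow> v = w"
  by (auto simp: proj_inverse_def)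

text \<open>Multiplication of \<open>F j k (1 / w)\<close> by \<open>w^6\<close> gives the
  difference of the two sides; its value at \<open>w = 0\<close> is the coefficient of
  \<open>y^6\<close>.\<close>

lemma F_root_proj_inverse:
  "F_root j k (proj_inverse w) \<longleftrightarrow>
     k * (w^3 - 3*j*w^2 + 3*j*w + j*(j - 2))^2 = j * (w^2 - 2*w + j)^3"
proof (cases "w = 0")
  case True
  have "k * (j * (j - 2))^2 - j * j^3 = j^2 * (j^2 * k - j^2 - 4 * j * k + 4 * k)"
    by (simp add: eval_nat_numeral algebra_simps)
  moreover have "F_root j k (proj_inverse w) \<longleftrightarrow> j^2 * (j^2 * k - j^2 - 4 * j * k + 4 * k) = 0"
    using True by (simp add: proj_inverse_def)
  ultimately have "F_root j k (proj_inverse w) \<longleftrightarrow> k * (j * (j - 2))^2 = j * j^3"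
    by (metis right_minus_eq)
  then show ?thesis using True by simp
next
  case False
  have "j^2 * (1/w)^3 - 2 * j * (1/w)^3 + 3 * j * (1/w)^2 - 3 * j * (1/w) + 1 =
      (w^3 - 3*j*w^2 + 3*j*w + j*(j - 2)) / w^3"
    using False by (simp add: field_simps eval_nat_numeral)
  moreover have "j * (1/w)^2 - 2 * (1/w) + 1 = (w^2 - 2*w + j) / w^2"
    using False by (simp add: field_simps eval_nat_numeral)
  ultimately have "F j k (1 / w) =
      k * (w^3 - 3*j*w^2 + 3*j*w + j*(j - 2))^2 / w^6 - j * (w^2 - 2*w + j)^3 / w^6"
    by (simp add: F_def power_divide flip: power_mult)
  then show ?thesis using False by (simp add: proj_inverse_def)
qed

text \<open>\<open>x\<close> is the affine coordinate with values \<open>v\<close> at 0 and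
  \<open>w\<close> at 1. In terms of it, \<open>s_poly\<close> is one fixed cubic up to scaling, and
  the limiting formulas are the cases \<open>v = 0\<close> and \<open>w = 0\<close>.\<close>

lemma poly_s_poly_proj_inverse:
  assumes "v \<noteq> w"
  defines "x \<equiv> \<lambda>t. v + (w - v) * t"
  shows "poly (s_poly j (proj_inverse v) (proj_inverse w)) t =
    (x t^3 - 3*j*x t^2 + 3*j*x t + j*(j - 2)) / (w - v)^3"
proof -
  consider "v = 0" "w \<noteq> 0" | "v \<noteq> 0" "w = 0" | "v \<noteq> 0" "w \<noteq> 0" using assms(1) by blast
  then show ?thesis
  proof cases
    case 1
    then show ?thesis
      by (simp add: proj_inverse_def x_def field_simps eval_nat_numeral)
  next
    case 2
    then show ?thesis
      by (simp add: proj_inverse_def x_def field_simps eval_nat_numeral)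
  next
    case 3
    define y where "y = x t"
    have "1 / v - 1 / w = (w - v) / (v * w)" using 3 by (simp add: field_simps)
    moreover have "- (1 / w) + t * (1 / w - 1 / v) = - y / (v * w)"
      using 3 by (simp add: y_def x_def field_simps)
    moreover have "1 / v * (1 / w) - 1 / w + t * (1 / w - 1 / v) = (1 - y) / (v * w)"
      using 3 by (simp add: y_def x_def field_simps)
    moreover have "w - v \<noteq> 0" using assms(1) by simp
    moreover have "v * w \<noteq> 0" using 3 by simp
    ultimately have "poly (s_poly j (proj_inverse v) (proj_inverse w)) t =
      (1 / ((w - v) / (v * w))^3) * ((j - 1) * (- y / (v * w))^3 + (j - 1) * j * (1/v)^3 * (1/w)^3
        - j * ((1 - y) / (v * w))^3)"
      using 3 by (simp add: proj_inverse_def)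
    also have "\<dots> = (- (j - 1) * y^3 + (j - 1) * j - j * (1 - y)^3) / (w - v)^3"
      using \<open>v * w \<noteq> 0\<close> \<open>w - v \<noteq> 0\<close> 3 by (simp add: power_divide power_mult_distrib field_simps)
    also have "\<dots> = (y^3 - 3*j*y^2 + 3*j*y + j*(j - 2)) / (w - v)^3"
      by (simp add: eval_nat_numeral algebra_simps)
    finally show ?thesis by (simp add: y_def)
  qed
qed

text \<open>The polynomial \<open>w^3 - 3 j w^2 + 3 j w + j (j - 2)\<close> has the depressed form
  \<open>x^3 - 3 j (j - 1) x - 2 j (j - 1)^2\<close> in \<open>x = w - j\<close>; the factor \<open>\<mu>\<close>
  is the scaling that matches \<open>y^3 - 3 H y + U\<close> with it.\<close>
lemma cubic_covariants:
  fixes a b c d H U E j \<mu> w :: rat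
  assumes H_def: "H = b^2 - 3*a * c" and U_def: "U = 2*b^3 - 9*a*b * c + 27*a^2*d"
    and E: "E \<noteq> 0" and syz: "4 * H^3 = U^2 + 27 * E" and H: "H \<noteq> 0"
    and j: "j = 4 * H^3 / (27 * E)" and \<mu>: "\<mu> = - 2 * U * H / (27 * E)"
  shows "w = j + \<mu> * (3*a*t + b) \<Longrightarrow>
      w^3 - 3*j*w^2 + 3*j*w + j*(j - 2) = \<mu>^3 * (27 * a^2 * poly [:d, c, b, a:] t)"
    and "w = j + \<mu> * b \<Longrightarrow> w^2 - 2*w + j = \<mu>^2 * (9 * a^2 * (c^2 - 3*d*b)) / H"
proof -
  have j1: "j - 1 = U^2 / (27 * E)" using syz E by (simp add: j field_simps)
  \<comment> \<open>\<open>r1\<close> and \<open>r3\<close> match the linear and constant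
    coefficients of the two depressed cubics under scaling by \<open>\<mu>\<close>.\<close>
  have r1: "j * (j - 1) = \<mu>^2 * H"
    unfolding j1 unfolding j \<mu> using E by (simp add: field_simps eval_nat_numeral)
  have r2: "2 * (j - 1) * H = - (U * \<mu>)"
    unfolding j1 \<mu> using E by (simp add: field_simps eval_nat_numeral)
  have r3: "2 * j * (j - 1)^2 = - (\<mu>^3 * U)"
  proof -
    have "2 * j * (j - 1)^2 = 2 * (j * (j - 1)) * (j - 1)" by (simp add: power2_eq_square)
    also have "\<dots> = \<mu>^2 * (2 * (j - 1) * H)" unfolding r1 by simp
    finally show ?thesis unfolding r2 by (simp add: power2_eq_square power3_eq_cube)
  qed
  {
    assume w: "w = j + \<mu> * (3*a*t + b)"
    define y where "y = 3*a*t + b"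
    have "w^3 - 3*j*w^2 + 3*j*w + j*(j - 2) = (\<mu> * y)^3 - 3 * (j * (j - 1)) * (\<mu> * y) - 2 * j * (j - 1)^2"
      unfolding w y_def[symmetric] by (simp add: eval_nat_numeral algebra_simps)
    also have "\<dots> = \<mu>^3 * (y^3 - 3 * H * y + U)"
      unfolding r1 r3 by (simp add: eval_nat_numeral algebra_simps)
    also have "y^3 - 3 * H * y + U = 27 * a^2 * poly [:d, c, b, a:] t"
      by (simp add: y_def H_def U_def eval_nat_numeral algebra_simps)
    finally show "w^3 - 3*j*w^2 + 3*j*w + j*(j - 2) = \<mu>^3 * (27 * a^2 * poly [:d, c, b, a:] t)" .
  }
  {
    assume w: "w = j + \<mu> * b"
    \<comment> \<open>The factor \<open>H\<close> makes the middle term an instance of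
      \<open>r2\<close>. What remains is \<open>9 * a^2\<close> times the analogue of
      \<open>H\<close> for the reversed cubic.\<close>
    have "H * (w^2 - 2*w + j) = H * (j * (j - 1)) + (2 * (j - 1) * H) * (\<mu> * b) + H * (\<mu> * b)^2"
      unfolding w by (simp add: eval_nat_numeral algebra_simps)
    also have "\<dots> = \<mu>^2 * (H^2 - U * b + H * b^2)"
      unfolding r1 r2 by (simp add: eval_nat_numeral algebra_simps)
    also have "H^2 - U * b + H * b^2 = 9 * a^2 * (c^2 - 3*d*b)"
      by (simp add: H_def U_def eval_nat_numeral algebra_simps)
    finally show "w^2 - 2*w + j = \<mu>^2 * (9 * a^2 * (c^2 - 3*d*b)) / H"
      using H by (simp add: field_simps)
  }
qed

text \<open>At \<open>t = 0\<close> the covariant identities make both sides of the root equation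
  multiples of \<open>\<mu>^6\<close>, and they agree when \<open>k\<close> is the j-invariant of
  the reversed cubic.\<close>

lemma F_root_cubic:
  fixes a b c d H U D j \<mu> :: rat
  assumes H_def: "H = b^2 - 3*a * c" and U_def: "U = 2*b^3 - 9*a*b * c + 27*a^2*d"
    and nz: "a \<noteq> 0" "D \<noteq> 0" "H \<noteq> 0" "d \<noteq> 0" and syz: "4 * H^3 = U^2 + 27 * (a^2 * D)"
    and j: "j = 4 * H^3 / (27 * (a^2 * D))" and \<mu>: "\<mu> = - 2 * U * H / (27 * (a^2 * D))"
  shows "F_root j (4 * (c^2 - 3*d*b)^3 / (27 * (d^2 * D))) (proj_inverse (j + \<mu> * b))"
proof -
  define w where "w = j + \<mu> * b"
  have E: "a^2 * D \<noteq> 0" using nz by simp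
  define G where "G = c^2 - 3*d*b"
  note cov = cubic_covariants[OF H_def U_def E syz nz(3) j \<mu>]
  have g: "w^3 - 3*j*w^2 + 3*j*w + j*(j - 2) = \<mu>^3 * (27 * a^2 * d)"
    using cov(1)[of w 0] by (simp add: w_def)
  have q: "w^2 - 2*w + j = \<mu>^2 * (9 * a^2 * G) / H"
    using cov(2)[of w] by (simp add: w_def G_def)
  have "4 * G^3 / (27 * (d^2 * D)) * (\<mu>^3 * (27 * a^2 * d))^2 = j * (\<mu>^2 * (9 * a^2 * G) / H)^3"
    unfolding j using nz by (simp add: field_simps eval_nat_numeral)
  then show ?thesis
    unfolding F_root_proj_inverse w_def[symmetric] G_def[symmetric] g q .
qed

text \<open>The reversed cubic has leading coefficient \<open>d\<close>, the same discriminant and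
  the same field. Its invariant is 0 exactly when \<open>c^2 - 3 * d * b\<close> vanishes, which
  accounts for the added 0.\<close>

lemma reversed_T32inf_class:
  fixes a b c d :: int
  defines "D \<equiv> disc_cubic [:d, c, b, a:]"
  assumes "finite P" "\<forall>p\<in>P. Factorial_Ring.prime p" "2 \<in> P" "3 \<in> P"
    and "in_class [:of_int d, of_int c, of_int b, of_int a:] K"
    and nr: "\<And>x :: rat. poly [:of_int d, of_int c, of_int b, of_int a:] x \<noteq> 0"
    and "a \<noteq> 0" "d \<in> P_star P" "D \<in> P_star P"
  shows "4 * of_int (c^2 - 3 * d * b)^3 / (27 * of_int (d^2 * D)) \<in> T32inf_class P K \<union> {0}"
proof (cases "c^2 - 3 * d * b = 0")
  case False
  have "disc_cubic [:a, b, c, d:] = D"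
    by (simp add: D_def disc_cubic_def Let_def eval_nat_numeral algebra_simps)
  moreover have "(of_int a :: rat) \<noteq> 0" using assms(8) by simp
  ultimately show ?thesis
    using T32inf_class_memI[OF assms(2-5) in_class_reversed[OF assms(6) _ nr] assms(9) _ False]
      assms(10) by simp
next
  case True
  show ?thesis unfolding True by simp
qed

section \<open>Recovering a cubic from its invariant and two points\<close>

theorem theorem5p1:
  fixes P :: "nat set" and K :: "'k ring" and j :: rat
  assumes "finite P" and "\<forall>p\<in>P. Factorial_Ring.prime p" and "2 \<in> P" and "3 \<in> P"
    and "cubic_number_field K" and "unramified_outside K P"
    and "j \<in> T32inf_class P K"
  shows "\<forall>s \<in> MPolys3_class P K. j_invariant s = j \<longrightarrow>
    (\<exists>j0 \<in> T32inf_class P K \<union> {0}. \<exists>j1 \<in> T32inf_class P K \<union> {0}. \<exists>m n.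
       F_root j j0 m \<and> F_root j j1 n \<and> m \<noteq> n \<and> s = s_poly j m n)"
proof (intro ballI impI)
  note P = assms(1-4)
  fix s assume "s \<in> MPolys3_class P K" and j_s: "j_invariant s = j"
  then obtain p where p: "p \<in> Polys3 P" and sK: "in_class s K"
    and s: "s = Polynomial.smult (1 / of_int (Polynomial.lead_coeff p)) (map_poly of_int p)"
    unfolding MPolys3_class_def MPolys3_def by blast
  have deg_p: "Polynomial.degree p = 3" and irr: "Factorial_Ring.irreducible p"
    using p by (auto simp: Polys3_def)
  obtain d c b a where p_eq: "p = [:d, c, b, a:]"
    using cubic_eq_coeffs[OF deg_p] by blast
  have a0: "a \<noteq> 0" using deg_p p_eq by (auto split: if_splits)
  define D where "D = disc_cubic [:d, c, b, a:]"
  \<comment> \<open>Coefficients of \<open>p(t + 1)\<close>, whose constant term is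
    \<open>p(1)\<close>.\<close>
  define d1 c1 b1 where "d1 = a + b + c + d" and "c1 = 3*a + 2*b + c" and "b1 = 3*a + b"
  have D1: "disc_cubic [:d1, c1, b1, a:] = D"
    by (simp add: D_def d1_def c1_def b1_def disc_cubic_def Let_def eval_nat_numeral algebra_simps)
  have Pst: "D \<in> P_star P" "d \<in> P_star P" "d1 \<in> P_star P"
    using p by (auto simp: Polys3_def p_eq D_def d1_def algebra_simps)
  then have nz: "D \<noteq> 0" "d \<noteq> 0" "d1 \<noteq> 0" using P_star_iff[OF P(1,2)] by auto
  define q :: "rat poly" where "q = [:of_int d, of_int c, of_int b, of_int a:]"
  define q1 :: "rat poly" where "q1 = [:of_int d1, of_int c1, of_int b1, of_int a:]"
  have q: "map_poly of_int p = q"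
    using a0 by (simp add: q_def p_eq map_poly_pCons)
  have nr: "poly q x \<noteq> 0" for x
    using irreducible_int_cubic_no_rat_root[OF irr deg_p] q by simp
  have deg: "Polynomial.degree q = 3" "Polynomial.degree q1 = 3"
    using a0 by (simp_all add: q_def q1_def)
  have s_q: "s = Polynomial.smult (1 / of_int a) q"
    using a0 by (simp add: s q) (simp add: p_eq)
  have q1_q: "poly q1 x = poly q (x + 1)" for x
    by (simp add: q_def q1_def d1_def c1_def b1_def algebra_simps)
  have qK: "in_class q K"
  proof (rule in_class_of_pcompose_linear[OF sK])
    show "Polynomial.degree s = 3" using deg a0 by (simp add: s_q)
    show "poly s x \<noteq> 0" for x using nr a0 by (simp add: s_q)
    show "pcompose q [:0, 1:] = Polynomial.smult (of_int a) s"
      using a0 by (simp add: s_q pcompose_idR)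
  qed (use deg in auto)
  have q1K: "in_class q1 K"
  proof (rule in_class_of_pcompose_linear[OF qK deg(1) nr deg(2)])
    show "pcompose q1 [:- 1, 1:] = Polynomial.smult 1 q"
      by (intro poly_eq_poly_eq_iff[THEN iffD1] ext) (simp add: poly_pcompose q1_q)
  qed simp
  have nr1: "poly q1 x \<noteq> 0" for x using nr q1_q by simp
  define H where "H = b^2 - 3*a * c"
  define U where "U = 2*b^3 - 9*a*b * c + 27*a^2*d"
  \<comment> \<open>\<open>H\<close> and \<open>U\<close> are invariant under translation, so one
    \<open>\<mu>\<close> serves both points.\<close>
  have H1: "H = b1^2 - 3*a * c1" and U1: "U = 2*b1^3 - 9*a*b1 * c1 + 27*a^2*d1"
    by (simp_all add: H_def U_def d1_def c1_def b1_def eval_nat_numeral algebra_simps)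
  have syz: "4 * H^3 = U^2 + 27 * (a^2 * D)"
    unfolding H_def U_def D_def by (rule cubic_syzygy)
  let ?H = "of_int H :: rat" and ?U = "of_int U :: rat" and ?D = "of_int D :: rat"
  let ?a = "of_int a :: rat"
  have syz_rat: "4 * ?H^3 = ?U^2 + 27 * (?a^2 * ?D)"
    using arg_cong[OF syz, of "of_int :: int \<Rightarrow> rat"] by simp
  have "j_invariant s = 4 * ?H^3 / (27 * (?a^2 * ?D))"
  proof -
    have coeffs: "Polynomial.coeff s 0 = of_int d / ?a" "Polynomial.coeff s 1 = of_int c / ?a"
      "Polynomial.coeff s 2 = of_int b / ?a" "Polynomial.coeff s 3 = 1"
      using a0 by (simp_all add: s_q q_def numeral_2_eq_2 numeral_3_eq_3)
    have "(of_int b / ?a)^2 - 3 * (of_int c / ?a) = ?H / ?a^2"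
      using a0 by (simp add: H_def field_simps power2_eq_square)
    moreover have "disc_cubic s = ?D / ?a^4"
      unfolding disc_cubic_def Let_def coeffs
      using a0 by (simp add: D_def disc_cubic_def Let_def field_simps eval_nat_numeral)
    ultimately have "j_invariant s = 4 * (?H / ?a^2)^3 / (27 * (?D / ?a^4))"
      unfolding j_invariant_def coeffs by simp
    then show ?thesis using a0 nz by (simp add: field_simps eval_nat_numeral)
  qed
  then have j: "j = 4 * ?H^3 / (27 * (?a^2 * ?D))" using j_s by simp
  have "j \<noteq> 0" "j \<noteq> 1" using assms(7) by (auto simp: T32inf_class_def T32inf_def)
  have H0: "?H \<noteq> 0" using \<open>j \<noteq> 0\<close> j by auto
  have U0: "?U \<noteq> 0"
  proof
    assume "?U = 0"
    then have "j = 1" using syz_rat a0 nz by (simp add: j)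
    with \<open>j \<noteq> 1\<close> show False ..
  qed
  define \<mu> where "\<mu> = - 2 * ?U * ?H / (27 * (?a^2 * ?D))"
  \<comment> \<open>\<open>v\<close> and \<open>w\<close> are the values at \<open>t = 0\<close> and
    \<open>t = 1\<close> of the affine map \<open>j + \<mu> * (3 * a * t + b)\<close>.\<close>
  define v where "v = j + \<mu> * of_int b"
  define w where "w = j + \<mu> * of_int b1"
  have wv: "w - v = 3 * ?a * \<mu>" by (simp add: v_def w_def b1_def algebra_simps)
  have \<mu>0: "\<mu> \<noteq> 0" using H0 U0 a0 nz by (simp add: \<mu>_def)
  then have "v \<noteq> w" using wv a0 by auto
  have nz_rat: "?a \<noteq> 0" "?D \<noteq> 0" "(of_int d :: rat) \<noteq> 0" "(of_int d1 :: rat) \<noteq> 0"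
    using a0 nz by simp_all
  have E0: "?a^2 * ?D \<noteq> 0" using nz_rat by simp
  have HU: "?H = (of_int b)^2 - 3 * ?a * of_int c"
    "?U = 2 * (of_int b)^3 - 9 * ?a * of_int b * of_int c + 27 * ?a^2 * of_int d"
    by (simp_all add: H_def U_def)
  have HU1: "?H = (of_int b1)^2 - 3 * ?a * of_int c1"
    "?U = 2 * (of_int b1)^3 - 9 * ?a * of_int b1 * of_int c1 + 27 * ?a^2 * of_int d1"
    by (simp_all add: H1 U1)
  have "F_root j (4 * of_int (c^2 - 3 * d * b)^3 / (27 * of_int (d^2 * D))) (proj_inverse v)"
    using F_root_cubic[OF HU nz_rat(1,2) H0 nz_rat(3) syz_rat j \<mu>_def] by (simp add: v_def)
  moreover have "F_root j (4 * of_int (c1^2 - 3 * d1 * b1)^3 / (27 * of_int (d1^2 * D))) (proj_inverse w)"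
    using F_root_cubic[OF HU1 nz_rat(1,2) H0 nz_rat(4) syz_rat j \<mu>_def] by (simp add: w_def)
  moreover have "4 * of_int (c^2 - 3 * d * b)^3 / (27 * of_int (d^2 * D)) \<in> T32inf_class P K \<union> {0}"
    using reversed_T32inf_class[OF P qK[unfolded q_def] nr[unfolded q_def] a0 Pst(2)] Pst(1)
    unfolding D_def by blast
  moreover have "4 * of_int (c1^2 - 3 * d1 * b1)^3 / (27 * of_int (d1^2 * D)) \<in> T32inf_class P K \<union> {0}"
    using reversed_T32inf_class[OF P q1K[unfolded q1_def] nr1[unfolded q1_def] a0 Pst(3)] Pst(1)
    unfolding D1 by blast
  \<comment> \<open>This excludes the diagonal, where \<open>s_poly\<close> has only a conventional
    value.\<close>
  moreover have "proj_inverse v \<noteq> proj_inverse w"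
    using \<open>v \<noteq> w\<close> by (simp add: proj_inverse_inject)
  \<comment> \<open>The covariant identity contributes the factor \<open>27 * a^2 * \<mu>^3\<close>,
    and \<open>(w - v)^3\<close> is \<open>27 * a^3 * \<mu>^3\<close>; the quotient leaves
    \<open>q\<close> divided by \<open>a\<close>, which is \<open>s\<close>.\<close>
  moreover have "s = s_poly j (proj_inverse v) (proj_inverse w)"
  proof (intro poly_eq_poly_eq_iff[THEN iffD1] ext)
    fix t
    define x where "x = v + (w - v) * t"
    have "x = j + \<mu> * (3 * ?a * t + of_int b)"
      unfolding x_def wv by (simp add: v_def algebra_simps)
    from cubic_covariants(1)[OF HU E0 syz_rat H0 j \<mu>_def this]
    have "x^3 - 3*j*x^2 + 3*j*x + j*(j - 2) = \<mu>^3 * (27 * ?a^2 * poly q t)"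
      by (simp only: q_def)
    then have "poly (s_poly j (proj_inverse v) (proj_inverse w)) t =
        \<mu>^3 * (27 * ?a^2 * poly q t) / (w - v)^3"
      unfolding poly_s_poly_proj_inverse[OF \<open>v \<noteq> w\<close>] x_def[symmetric] by simp
    also have "\<dots> = poly s t"
      unfolding wv using \<mu>0 nz_rat(1) by (simp add: s_q field_simps eval_nat_numeral)
    finally show "poly s t = poly (s_poly j (proj_inverse v) (proj_inverse w)) t" ..
  qed
  ultimately show "\<exists>j0 \<in> T32inf_class P K \<union> {0}. \<exists>j1 \<in> T32inf_class P K \<union> {0}. \<exists>m n.
       F_root j j0 m \<and> F_root j j1 n \<and> m \<noteq> n \<and> s = s_poly j m n"
    by blast
qed

end
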